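(* The set functions $S_R\mapsto v^*(S_R)$ and $S_R\mapsto \hat v(S_R)$ on subsets of $S_A$ are not submodular functions in general; that is, there is an SRAMF instance for which $v^*$ is not submodular and $\hat v$ is not submodular.
   Context: SRAMF instance: disjoint finite sets of vehicles $S_A$ and $S_B$ (possibly empty), and $N$ scenarios $\xi$. Each scenario $\xi$ has a finite set $D(\xi)$ of requests and a finite set $E(\xi)$ of hyperedges; each hyperedge consists of exactly one vehicle of $S_A\cup S_B$ and a nonempty set of requests of $D(\xi)$ (within the capacity of the vehicle), and has a value $v_e\ge0$. For $S_R\subseteq S_A$, $\hat v(S_R,\xi)$ is the optimal value of the linear program: maximize $\sum_{e\in E(\xi)}v_ex_e$ subject to $\sum_{e\in E(\xi):\,j\in e}x_e\le 1$ for all $j\in D(\xi)$; $\sum_{e\in E(\xi):\,i\in e}x_e\le 1$ for all $i\in S_A\cup S_B$; $x_e=0$ for every $e$ containing a vehicle of $S_A\setminus S_R$; $x_e\ge 0$. $v(S_R,\xi)$ is the optimal value of the same program with $x_e\in\{0,1\}$. Put $\hat v(S_R)=\frac1N\sum_\xi\hat v(S_R,\xi)$ and $v^*(S_R)=\frac1N\sum_\xi v(S_R,\xi)$. A function $f:2^\Omega\to\mathbb R_+$ is submodular if $f(U\cup\{i\})-f(U)\ge f(W\cup\{i\})-f(W)$ for all $U\subseteq W\subseteq\Omega$ and $i\in\Omega\setminus W$. *)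

theory Defs
  imports Complex_Main
begin

text \<open>
  A hyperedge is encoded as a pair of its unique vehicle and its set of requests.
  Vehicles and requests live in separate types, hence are automatically disjoint.
\<close>

type_synonym ('v, 'r) hyperedge = "'v \<times> 'r set"

text \<open>Scenarios are the indices \<open>\<xi> < num_scenarios\<close>.\<close>

record ('v, 'r) sramf =
  fleet_A :: "'v set"
  fleet_B :: "'v set"
  capacity :: "'v \<Rightarrow> nat"
  num_scenarios :: nat
  requests :: "nat \<Rightarrow> 'r set"
  hyperedges :: "nat \<Rightarrow> ('v, 'r) hyperedge set"
  edge_value :: "nat \<Rightarrow> ('v, 'r) hyperedge \<Rightarrow> real"

definition sramf_instance :: "('v, 'r) sramf \<Rightarrow> bool" where
  "sramf_instance I \<longleftrightarrow>
     finite (fleet_A I) \<and> finite (fleet_B I) \<and> fleet_A I \<inter> fleet_B I = {} \<and>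
     num_scenarios I \<ge> 1 \<and>
     (\<forall>\<xi><num_scenarios I.
        finite (requests I \<xi>) \<and> finite (hyperedges I \<xi>) \<and>
        (\<forall>(i, R)\<in>hyperedges I \<xi>.
           i \<in> fleet_A I \<union> fleet_B I \<and> R \<noteq> {} \<and> R \<subseteq> requests I \<xi> \<and>
           card R \<le> capacity I i \<and> edge_value I \<xi> (i, R) \<ge> 0))"

definition lp_feasible ::
    "('v, 'r) sramf \<Rightarrow> 'v set \<Rightarrow> nat \<Rightarrow> (('v, 'r) hyperedge \<Rightarrow> real) \<Rightarrow> bool" where
  "lp_feasible I S \<xi> x \<longleftrightarrow>
     (\<forall>j\<in>requests I \<xi>. (\<Sum>e\<in>{e \<in> hyperedges I \<xi>. j \<in> snd e}. x e) \<le> 1) \<and>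
     (\<forall>i\<in>fleet_A I \<union> fleet_B I. (\<Sum>e\<in>{e \<in> hyperedges I \<xi>. fst e = i}. x e) \<le> 1) \<and>
     (\<forall>e\<in>hyperedges I \<xi>. fst e \<in> fleet_A I - S \<longrightarrow> x e = 0) \<and>
     (\<forall>e\<in>hyperedges I \<xi>. x e \<ge> 0)"

definition ip_feasible ::
    "('v, 'r) sramf \<Rightarrow> 'v set \<Rightarrow> nat \<Rightarrow> (('v, 'r) hyperedge \<Rightarrow> real) \<Rightarrow> bool" where
  "ip_feasible I S \<xi> x \<longleftrightarrow>
     lp_feasible I S \<xi> x \<and> (\<forall>e\<in>hyperedges I \<xi>. x e \<in> {0, 1})"

definition objective ::
    "('v, 'r) sramf \<Rightarrow> nat \<Rightarrow> (('v, 'r) hyperedge \<Rightarrow> real) \<Rightarrow> real" where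
  "objective I \<xi> x = (\<Sum>e\<in>hyperedges I \<xi>. edge_value I \<xi> e * x e)"

text \<open>
  Both suprema are over nonempty bounded sets whenever \<open>sramf_instance I\<close> holds
  (lemmas \<open>zero_feasible\<close> and \<open>objective_bdd_above\<close> below).
\<close>

definition lp_value :: "('v, 'r) sramf \<Rightarrow> 'v set \<Rightarrow> nat \<Rightarrow> real" where
  "lp_value I S \<xi> = Sup {objective I \<xi> x | x. lp_feasible I S \<xi> x}"

definition ip_value :: "('v, 'r) sramf \<Rightarrow> 'v set \<Rightarrow> nat \<Rightarrow> real" where
  "ip_value I S \<xi> = Sup {objective I \<xi> x | x. ip_feasible I S \<xi> x}"

definition v_hat :: "('v, 'r) sramf \<Rightarrow> 'v set \<Rightarrow> real" where
  "v_hat I S = (1 / real (num_scenarios I)) * (\<Sum>\<xi><num_scenarios I. lp_value I S \<xi>)"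

definition v_star :: "('v, 'r) sramf \<Rightarrow> 'v set \<Rightarrow> real" where
  "v_star I S = (1 / real (num_scenarios I)) * (\<Sum>\<xi><num_scenarios I. ip_value I S \<xi>)"

text \<open>
  Nonnegativity of \<open>f\<close> is deliberately not part of this predicate, so that its negation
  can only come from a violated inequality; \<open>v_hat\<close> and \<open>v_star\<close> are nonnegative by
  the lemmas at the end.
\<close>

definition submodular_on :: "'a set \<Rightarrow> ('a set \<Rightarrow> real) \<Rightarrow> bool" where
  "submodular_on \<Omega> f \<longleftrightarrow>
     (\<forall>U W i. U \<subseteq> W \<and> W \<subseteq> \<Omega> \<and> i \<in> \<Omega> - W \<longrightarrow>
        f (U \<union> {i}) - f U \<ge> f (W \<union> {i}) - f W)"

lemma zero_feasible: "ip_feasible I S \<xi> (\<lambda>_. 0)" "lp_feasible I S \<xi> (\<lambda>_. 0)"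
  by (auto simp: ip_feasible_def lp_feasible_def)

lemma objective_bdd_above:
  assumes "sramf_instance I" "\<xi> < num_scenarios I"
  shows "bdd_above {objective I \<xi> x | x. lp_feasible I S \<xi> x}"
    and "bdd_above {objective I \<xi> x | x. ip_feasible I S \<xi> x}"
proof -
  have fin: "finite (hyperedges I \<xi>)"
    and veh: "\<And>e. e \<in> hyperedges I \<xi> \<Longrightarrow> fst e \<in> fleet_A I \<union> fleet_B I"
    and val: "\<And>e. e \<in> hyperedges I \<xi> \<Longrightarrow> edge_value I \<xi> e \<ge> 0"
    using assms by (fastforce simp: sramf_instance_def)+
  have *: "objective I \<xi> x \<le> (\<Sum>e\<in>hyperedges I \<xi>. edge_value I \<xi> e)"
    if x: "lp_feasible I S \<xi> x" for x
    unfolding objective_def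
  proof (rule sum_mono)
    fix e assume e: "e \<in> hyperedges I \<xi>"
    have "x e \<le> (\<Sum>e'\<in>{e' \<in> hyperedges I \<xi>. fst e' = fst e}. x e')"
      using e fin x by (intro member_le_sum) (auto simp: lp_feasible_def)
    also have "\<dots> \<le> 1"
      using x veh[OF e] by (auto simp: lp_feasible_def)
    finally show "edge_value I \<xi> e * x e \<le> edge_value I \<xi> e"
      using val[OF e] by (simp add: mult_left_le)
  qed
  show "bdd_above {objective I \<xi> x | x. lp_feasible I S \<xi> x}"
    using * by (auto simp: bdd_above_def)
  show "bdd_above {objective I \<xi> x | x. ip_feasible I S \<xi> x}"
    using * by (auto simp: bdd_above_def ip_feasible_def)
qed

lemma lp_value_nonneg:
  assumes "sramf_instance I" "\<xi> < num_scenarios I"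
  shows "lp_value I S \<xi> \<ge> 0"
  unfolding lp_value_def
  by (rule cSup_upper[OF _ objective_bdd_above(1)[OF assms]])
     (auto simp: objective_def intro!: exI[of _ "\<lambda>_. 0"] zero_feasible)

lemma ip_value_nonneg:
  assumes "sramf_instance I" "\<xi> < num_scenarios I"
  shows "ip_value I S \<xi> \<ge> 0"
  unfolding ip_value_def
  by (rule cSup_upper[OF _ objective_bdd_above(2)[OF assms]])
     (auto simp: objective_def intro!: exI[of _ "\<lambda>_. 0"] zero_feasible)

lemma v_hat_nonneg: "sramf_instance I \<Longrightarrow> v_hat I S \<ge> 0"
  by (auto simp: v_hat_def intro!: divide_nonneg_nonneg sum_nonneg lp_value_nonneg)

lemma v_star_nonneg: "sramf_instance I \<Longrightarrow> v_star I S \<ge> 0"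
  by (auto simp: v_star_def intro!: divide_nonneg_nonneg sum_nonneg ip_value_nonneg)

end

theory Submission
  imports Defs
begin

text \<open>
  Vehicle \<open>2\<close> of the second fleet serves the requests \<open>{0, 1}\<close> jointly for value 3, whereas
  vehicle \<open>j \<in> {0, 1}\<close> of the first fleet serves only request \<open>j\<close>, for value 2. A single added
  vehicle competes with vehicle \<open>2\<close> and gains nothing, but the two together replace it
  and gain 1. So the values at \<open>{}\<close>, \<open>{0}\<close>, \<open>{1}\<close>, \<open>{0, 1}\<close> are 3, 3, 3, 4, and the
  linear relaxation does not change them.
\<close>

definition complementary_vehicles :: "(nat, nat) sramf" where
  "complementary_vehicles =
     \<lparr>fleet_A = {0, 1}, fleet_B = {2}, capacity = (\<lambda>_. 2), num_scenarios = 1,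
      requests = (\<lambda>_. {0, 1}),
      hyperedges = (\<lambda>_. {(0, {0}), (1, {1}), (2, {0, 1})}),
      edge_value = (\<lambda>_ e. if fst e = 2 then 3 else 2)\<rparr>"

lemma sramf_instance_complementary_vehicles: "sramf_instance complementary_vehicles"
  by (auto simp: sramf_instance_def complementary_vehicles_def)

lemma objective_complementary_vehicles:
  "objective complementary_vehicles \<xi> x = 2 * x (0, {0}) + 2 * x (1, {1}) + 3 * x (2, {0, 1})"
  by (simp add: objective_def complementary_vehicles_def)

text \<open>Every vehicle has a single hyperedge, so the vehicle constraints only say
  \<open>x e \<le> 1\<close>, which the request constraints and nonnegativity already imply.\<close>

lemma lp_feasible_complementary_vehicles_iff:
  "lp_feasible complementary_vehicles S \<xi> x \<longleftrightarrow>
     x (0, {0}) \<ge> 0 \<and> x (1, {1}) \<ge> 0 \<and> x (2, {0, 1}) \<ge> 0 \<and>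
     x (0, {0}) + x (2, {0, 1}) \<le> 1 \<and> x (1, {1}) + x (2, {0, 1}) \<le> 1 \<and>
     (0 \<notin> S \<longrightarrow> x (0, {0}) = 0) \<and> (1 \<notin> S \<longrightarrow> x (1, {1}) = 0)"
proof -
  \<comment> \<open>Keeping \<open>P\<close> arbitrary lets one expansion over the three distinct
    hyperedges serve both the request sums and the vehicle sums.\<close>
  have filter: "(\<Sum>e\<in>{e \<in> hyperedges complementary_vehicles \<xi>. P e}. x e) =
      (if P (0, {0}) then x (0, {0}) else 0) + (if P (1, {1}) then x (1, {1}) else 0) +
      (if P (2, {0, 1}) then x (2, {0, 1}) else 0)" for P
    by (subst sum.inter_filter) (simp_all add: complementary_vehicles_def)
  show ?thesis
    unfolding lp_feasible_def filter by (auto simp: complementary_vehicles_def)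
qed

text \<open>If vehicle 0 is missing, write \<open>p\<close>, \<open>q\<close> for the weights of the
  edges of vehicles 1 and 2: the objective is
  \<open>2 * p + 3 * q = 2 * (p + q) + q \<le> 3\<close>, as \<open>p + q \<le> 1\<close>. The other
  case is symmetric. Integral solutions inherit this fractional bound.\<close>

lemma complementary_vehicles_upper:
  assumes "0 \<notin> S \<or> 1 \<notin> S"
  shows "v_star complementary_vehicles S \<le> 3" "v_hat complementary_vehicles S \<le> 3"
proof -
  have bound: "objective complementary_vehicles 0 x \<le> 3"
    if "lp_feasible complementary_vehicles S 0 x" for x
    using that assms
    by (auto simp: lp_feasible_complementary_vehicles_iff objective_complementary_vehicles)
  have "ip_value complementary_vehicles S 0 \<le> 3"
    unfolding ip_value_def
    \<comment> \<open>The zero solution makes the set nonempty, as a least-upper-bound argument for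
      \<open>Sup\<close> on the reals requires.\<close>
    by (rule cSup_least) (use zero_feasible(1) in blast, use bound in \<open>auto simp: ip_feasible_def\<close>)
  moreover have "lp_value complementary_vehicles S 0 \<le> 3"
    unfolding lp_value_def
    by (rule cSup_least) (use zero_feasible(2) in blast, use bound in auto)
  ultimately show "v_star complementary_vehicles S \<le> 3" "v_hat complementary_vehicles S \<le> 3"
    by (simp_all add: v_star_def v_hat_def complementary_vehicles_def)
qed

text \<open>One integral witness bounds both functions from below, being feasible for the relaxation
  too; with a single scenario the average is that scenario's value.\<close>

lemma complementary_vehicles_lower:
  assumes "ip_feasible complementary_vehicles S 0 x"
  shows "v_star complementary_vehicles S \<ge> objective complementary_vehicles 0 x"
    and "v_hat complementary_vehicles S \<ge> objective complementary_vehicles 0 x"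
proof -
  have scen: "0 < num_scenarios complementary_vehicles"
    by (simp add: complementary_vehicles_def)
  note bdd = objective_bdd_above[OF sramf_instance_complementary_vehicles scen]
  have "ip_value complementary_vehicles S 0 \<ge> objective complementary_vehicles 0 x"
    unfolding ip_value_def by (rule cSup_upper[OF _ bdd(2)]) (use assms in auto)
  moreover have "lp_value complementary_vehicles S 0 \<ge> objective complementary_vehicles 0 x"
    unfolding lp_value_def
    by (rule cSup_upper[OF _ bdd(1)]) (use assms in \<open>auto simp: ip_feasible_def\<close>)
  ultimately show "v_star complementary_vehicles S \<ge> objective complementary_vehicles 0 x"
    and "v_hat complementary_vehicles S \<ge> objective complementary_vehicles 0 x"
    by (simp_all add: v_star_def v_hat_def complementary_vehicles_def)
qed

lemma complementary_vehicles_lower_empty: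
  "v_star complementary_vehicles {} \<ge> 3" "v_hat complementary_vehicles {} \<ge> 3"
proof -
  \<comment> \<open>Vehicle 2 serves both requests, for value 3.\<close>
  let ?x = "\<lambda>e :: (nat, nat) hyperedge. if fst e = 2 then 1 else 0 :: real"
  have "ip_feasible complementary_vehicles {} 0 ?x"
    by (auto simp: ip_feasible_def lp_feasible_complementary_vehicles_iff)
  from complementary_vehicles_lower[OF this]
  show "v_star complementary_vehicles {} \<ge> 3" "v_hat complementary_vehicles {} \<ge> 3"
    by (simp_all add: objective_complementary_vehicles)
qed

lemma complementary_vehicles_lower_both:
  "v_star complementary_vehicles {0, 1} \<ge> 4" "v_hat complementary_vehicles {0, 1} \<ge> 4"
proof -
  \<comment> \<open>Vehicles 0 and 1 each serve their own request, for value 2 + 2.\<close>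
  let ?x = "\<lambda>e :: (nat, nat) hyperedge. if fst e = 2 then 0 else 1 :: real"
  have "ip_feasible complementary_vehicles {0, 1} 0 ?x"
    by (auto simp: ip_feasible_def lp_feasible_complementary_vehicles_iff)
  from complementary_vehicles_lower[OF this]
  show "v_star complementary_vehicles {0, 1} \<ge> 4" "v_hat complementary_vehicles {0, 1} \<ge> 4"
    by (simp_all add: objective_complementary_vehicles)
qed

text \<open>This is the case \<open>U = {}\<close>, \<open>W = {b}\<close>, \<open>i = a\<close>. In
  additive form, upper bounds at the singletons and lower bounds at the other two sets suffice; no
  exact value is needed.\<close>

lemma not_submodular_onI:
  assumes "a \<in> \<Omega>" "b \<in> \<Omega>" "a \<noteq> b" "f {a} + f {b} < f {} + f {a, b}"
  shows "\<not> submodular_on \<Omega> f"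
proof
  assume "submodular_on \<Omega> f"
  then have "f ({} \<union> {a}) - f {} \<ge> f ({b} \<union> {a}) - f {b}"
    using assms(1-3) unfolding submodular_on_def by blast
  then show False
    using assms(4) by (simp add: insert_commute)
qed

theorem proposition2:
  "\<exists>I :: (nat, nat) sramf. sramf_instance I \<and>
     \<not> submodular_on (fleet_A I) (v_star I) \<and>
     \<not> submodular_on (fleet_A I) (v_hat I)"
proof (intro exI conjI)
  have fleet: "0 \<in> fleet_A complementary_vehicles" "1 \<in> fleet_A complementary_vehicles"
    by (simp_all add: complementary_vehicles_def)
  note upper = complementary_vehicles_upper[of "{0}"] complementary_vehicles_upper[of "{1}"]
  show "sramf_instance complementary_vehicles"
    by (rule sramf_instance_complementary_vehicles)
  show "\<not> submodular_on (fleet_A complementary_vehicles) (v_star complementary_vehicles)"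
    \<comment> \<open>The violated inequality comes from 3 + 3 < 3 + 4.\<close>
    by (rule not_submodular_onI[OF fleet])
       (use upper complementary_vehicles_lower_empty complementary_vehicles_lower_both in auto)
  show "\<not> submodular_on (fleet_A complementary_vehicles) (v_hat complementary_vehicles)"
    by (rule not_submodular_onI[OF fleet])
       (use upper complementary_vehicles_lower_empty complementary_vehicles_lower_both in auto)
qed

end
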